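(* Let $\hat{\mathbf L}$, $\hat{\mathbf C}$ be some estimators of $\mathbf L$, $\mathbf C$. Assume that there exists a randomized prediction function $\boldsymbol\pi$ such that $\mathbb E[\mathbf C(\mathbf X)\boldsymbol\pi(\mathbf X)]<0$ (componentwise), and additionally that there exists a randomized prediction function $\boldsymbol\pi$ such that $\mathbb E[\hat{\mathbf C}(\mathbf X)\boldsymbol\pi(\mathbf X)]<0$ (componentwise). Let $$\hat\Delta_{\mathrm{loss}}=\mathbb E\|\mathbf L(\mathbf X)-\hat{\mathbf L}(\mathbf X)\|_\infty,\qquad \hat\Delta_{\mathrm{constr}}=\Big(\mathbb E\|\mathbf C(\mathbf X)-\hat{\mathbf C}(\mathbf X)\|_{1\to2}^2\Big)^{1/2}.$$ For any $\alpha>0$, $\beta>0$, $\boldsymbol\lambda\in\mathbb R_+^M$, the randomized classifier $\hat{\boldsymbol\pi}_{\boldsymbol\lambda}$ satisfies $$\sqrt{\sum_{j\in[M]}\big(\mathcal C_j(\hat{\boldsymbol\pi}_{\boldsymbol\lambda})\big)_+^2}\le\|\hat{\mathbf G}_\alpha(\boldsymbol\lambda)\|+\hat\Delta_{\mathrm{constr}} .$$ Furthermore, for any randomized prediction function $\boldsymbol\pi$ with $\mathcal C_j(\boldsymbol\pi)\le0$ for all $j\in[M]$, $$\mathcal R(\hat{\boldsymbol\pi}_{\boldsymbol\lambda})\le\mathcal R(\boldsymbol\pi)+\big(\|\boldsymbol\lambda\|+\alpha\,\mathbb E_{\mathbf X}\|\hat{\mathbf C}(\mathbf X)\|_{1\to2}\big)\,\|\hat{\mathbf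 G}_\alpha(\boldsymbol\lambda)\|+2\hat\Delta_{\mathrm{loss}}+\hat\Delta_{\mathrm{constr}}\|\boldsymbol\lambda\|+\frac{2\log(|\mathcal A|)}{\beta}.$$
   Context: Setting. $\mathcal X$ is a feature space, $\mathbf X\sim\mathbb P_{\mathbf X}$ is a random element of $\mathcal X$, $\mathcal A$ is a finite set of predictions, $M\ge0$ an integer, $[M]=\{1,\dots,M\}$. There are (measurable) functions $\ell:\mathcal X\times\mathcal A\to\mathbb R$ (loss) and $c_j:\mathcal X\times\mathcal A\to\mathbb R$, $j\in[M]$ (costs). Put $\mathbf L(\mathbf x)=(\ell(\mathbf x,a))_{a\in\mathcal A}\in\mathbb R^{|\mathcal A|}$ and $\mathbf C(\mathbf x)=(c_j(\mathbf x,a))_{j\in[M],a\in\mathcal A}\in\mathbb R^{M\times|\mathcal A|}$. A randomized prediction function (randomized classifier) is a Markov kernel $\pi$ from $\mathcal X$ to $\mathcal A$, identified with $\boldsymbol\pi(\mathbf x)=(\pi(a\mid\mathbf x))_{a\in\mathcal A}$. Its risk and costs are $\mathcal R(\boldsymbol\pi)=\mathbb E_{\mathbf X}[\sum_{a}\ell(\mathbf X,a)\pi(a\mid\mathbf X)]$ and $\mathcal C_j(\boldsymbol\pi)=\mathbb E_{\mathbf X}[\sum_a c_j(\mathbf X,a)\pi(a\mid\mathbf X)]$. Estimators $\hat{\mathbf L}:\mathcal X\to\mathbb R^{|\mathcal A|}$, $\hat{\mathbf C}:\mathcal X\to\mathbb R^{M\times|\mathcal A|}$ are given (arbitrary, fixed,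 measurable) functions; all expectations are over $\mathbf X\sim\mathbb P_{\mathbf X}$ with the estimators held fixed. It is assumed that $\mathbb E\|\mathbf L(\mathbf X)\|$, $\mathbb E\|\hat{\mathbf L}(\mathbf X)\|$, $\mathbb E\|\mathbf C(\mathbf X)\|_{2\to2}$, $\mathbb E\|\hat{\mathbf C}(\mathbf X)\|_{2\to2}$ and $\mathbb E\|\mathbf C(\mathbf X)-\hat{\mathbf C}(\mathbf X)\|_{1\to2}^2$ are finite. Notation. $\|\cdot\|$ is the Euclidean norm; $\|\mathbf A\|_{p\to q}=\sup\{\|\mathbf A\mathbf w\|_q:\|\mathbf w\|_p=1\}$; $(a)_+=\max\{a,0\}$, componentwise for vectors. For $\mathbf w\in\mathbb R^m$, $\mathrm{LSE}_\beta(\mathbf w)=\beta^{-1}\log(\sum_{j=1}^m e^{\beta w_j})$. Define $\hat F(\boldsymbol\lambda)=\mathbb E_{\mathbf X}[\mathrm{LSE}_\beta(-\hat{\mathbf L}(\mathbf X)-\hat{\mathbf C}(\mathbf X)^\top\boldsymbol\lambda)]$, $\hat\pi_{\boldsymbol\lambda}(a\mid\mathbf x)\propto\exp\big(\beta(-\hat{\mathbf L}(\mathbf x)-\hat{\mathbf C}(\mathbf x)^\top\boldsymbol\lambda)_a\big)$ for $a\in\mathcal A$ (normalized to sum to one over $\mathcal A$), and $\hat{\mathbf G}_\alpha(\boldsymbol\lambda)=\frac{1}{\alpha}\big(\boldsymbol\lambda-(\boldsymbol\lambda-\alpha\nabla\hat F(\boldsymbol\lambda))_+\big)$. *)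

theory Defs
  imports "HOL-Probability.Probability"
begin

text \<open>
  The set of predictions is a finite type \<open>'a\<close>, so that a vector indexed by predictions is a
  \<open>real ^ 'a\<close>. The number \<open>M\<close> of constraints may be zero, which a type index cannot express;
  vectors indexed by \<open>[M]\<close> are therefore functions on \<open>nat\<close> of which only the values on \<open>{1..M}\<close>
  matter, with Euclidean norm \<open>L2_set _ {1..M}\<close>, and an \<open>M \<times> |A|\<close> matrix is given
  by its rows \<open>nat \<Rightarrow> real ^ 'a\<close>.
\<close>

definition mat_vec :: "(nat \<Rightarrow> real ^ 'a) \<Rightarrow> real ^ 'a \<Rightarrow> nat \<Rightarrow> real" where
  "mat_vec A w = (\<lambda>j. \<Sum>a\<in>UNIV. A j $ a * w $ a)"

definition transpose_vec :: "nat \<Rightarrow> (nat \<Rightarrow> real ^ 'a) \<Rightarrow> (nat \<Rightarrow> real) \<Rightarrow> real ^ 'a" where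
  "transpose_vec M A lam = (\<chi> a. \<Sum>j\<in>{1..M}. A j $ a * lam j)"

definition opnorm_1_2 :: "nat \<Rightarrow> (nat \<Rightarrow> real ^ 'a) \<Rightarrow> real" where
  "opnorm_1_2 M A = Sup {L2_set (mat_vec A w) {1..M} | w. (\<Sum>a\<in>UNIV. \<bar>w $ a\<bar>) = 1}"

definition opnorm_2_2 :: "nat \<Rightarrow> (nat \<Rightarrow> real ^ 'a) \<Rightarrow> real" where
  "opnorm_2_2 M A = Sup {L2_set (mat_vec A w) {1..M} | w. norm w = 1}"

text \<open>A randomized prediction function is a Markov kernel from the feature space to the
  (discrete) space of predictions.\<close>

definition randomized_prediction :: "'x measure \<Rightarrow> ('x \<Rightarrow> 'a::finite measure) \<Rightarrow> bool" where
  "randomized_prediction P \<pi> \<longleftrightarrow> \<pi> \<in> P \<rightarrow>\<^sub>M prob_algebra (count_space UNIV)"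

definition risk :: "'x measure \<Rightarrow> ('x \<Rightarrow> real ^ 'a) \<Rightarrow> ('x \<Rightarrow> 'a measure) \<Rightarrow> real" where
  "risk P L \<pi> = (\<integral>x. (\<Sum>a\<in>UNIV. L x $ a * measure (\<pi> x) {a}) \<partial>P)"

definition cost ::
  "'x measure \<Rightarrow> ('x \<Rightarrow> nat \<Rightarrow> real ^ 'a) \<Rightarrow> nat \<Rightarrow> ('x \<Rightarrow> 'a measure) \<Rightarrow> real" where
  "cost P C j \<pi> = (\<integral>x. (\<Sum>a\<in>UNIV. C x j $ a * measure (\<pi> x) {a}) \<partial>P)"

definition LSE :: "real \<Rightarrow> real ^ 'm \<Rightarrow> real" where
  "LSE \<beta> w = ln (\<Sum>j\<in>UNIV. exp (\<beta> * w $ j)) / \<beta>"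

definition score ::
  "nat \<Rightarrow> ('x \<Rightarrow> real ^ 'a) \<Rightarrow> ('x \<Rightarrow> nat \<Rightarrow> real ^ 'a) \<Rightarrow> (nat \<Rightarrow> real) \<Rightarrow> 'x \<Rightarrow> real ^ 'a" where
  "score M L C lam x = - L x - transpose_vec M (C x) lam"

definition dual_objective ::
  "'x measure \<Rightarrow> nat \<Rightarrow> real \<Rightarrow> ('x \<Rightarrow> real ^ 'a) \<Rightarrow> ('x \<Rightarrow> nat \<Rightarrow> real ^ 'a) \<Rightarrow>
    (nat \<Rightarrow> real) \<Rightarrow> real" where
  "dual_objective P M \<beta> L C lam = (\<integral>x. LSE \<beta> (score M L C lam x) \<partial>P)"

definition softmax_classifier ::
  "nat \<Rightarrow> real \<Rightarrow> ('x \<Rightarrow> real ^ 'a) \<Rightarrow> ('x \<Rightarrow> nat \<Rightarrow> real ^ 'a) \<Rightarrow>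
    (nat \<Rightarrow> real) \<Rightarrow> 'x \<Rightarrow> 'a measure" where
  "softmax_classifier M \<beta> L C lam x =
    point_measure UNIV (\<lambda>a. ennreal (exp (\<beta> * score M L C lam x $ a) /
      (\<Sum>b\<in>UNIV. exp (\<beta> * score M L C lam x $ b))))"

text \<open>The gradient as the vector of partial derivatives.\<close>

definition grad :: "((nat \<Rightarrow> real) \<Rightarrow> real) \<Rightarrow> (nat \<Rightarrow> real) \<Rightarrow> nat \<Rightarrow> real" where
  "grad F lam = (\<lambda>j. deriv (\<lambda>t. F (lam(j := t))) (lam j))"

definition grad_mapping ::
  "'x measure \<Rightarrow> nat \<Rightarrow> real \<Rightarrow> real \<Rightarrow> ('x \<Rightarrow> real ^ 'a) \<Rightarrow> ('x \<Rightarrow> nat \<Rightarrow> real ^ 'a) \<Rightarrow>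
    (nat \<Rightarrow> real) \<Rightarrow> nat \<Rightarrow> real" where
  "grad_mapping P M \<alpha> \<beta> L C lam =
    (\<lambda>j. (1 / \<alpha>) * (lam j - max (lam j - \<alpha> * grad (dual_objective P M \<beta> L C) lam j) 0))"

definition \<Delta>_loss :: "'x measure \<Rightarrow> ('x \<Rightarrow> real ^ 'a) \<Rightarrow> ('x \<Rightarrow> real ^ 'a) \<Rightarrow> real" where
  "\<Delta>_loss P L Lh = (\<integral>x. infnorm (L x - Lh x) \<partial>P)"

definition \<Delta>_constr ::
  "'x measure \<Rightarrow> nat \<Rightarrow> ('x \<Rightarrow> nat \<Rightarrow> real ^ 'a) \<Rightarrow> ('x \<Rightarrow> nat \<Rightarrow> real ^ 'a) \<Rightarrow> real" where
  "\<Delta>_constr P M C Ch = sqrt (\<integral>x. (opnorm_1_2 M (\<lambda>j. C x j - Ch x j))\<^sup>2 \<partial>P)"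

lemma measure_softmax_classifier:
  "measure (softmax_classifier M \<beta> L C lam x) {a} =
    exp (\<beta> * score M L C lam x $ a) / (\<Sum>b\<in>UNIV. exp (\<beta> * score M L C lam x $ b))"
  by (simp add: softmax_classifier_def measure_def emeasure_point_measure_finite sum_nonneg)

lemma randomized_prediction_softmax_classifier:
  fixes Lh :: "'x \<Rightarrow> real ^ 'a" and Ch :: "'x \<Rightarrow> nat \<Rightarrow> real ^ 'a"
  assumes [measurable]: "Lh \<in> borel_measurable P"
    and Ch: "\<And>j. j \<in> {1..M} \<Longrightarrow> (\<lambda>x. Ch x j) \<in> borel_measurable P"
  shows "randomized_prediction P (softmax_classifier M \<beta> Lh Ch lam)"
proof -
  let ?e = "\<lambda>x a. exp (\<beta> * score M Lh Ch lam x $ a)"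
  have nth: "(\<lambda>v::real^'a. v $ a) \<in> borel_measurable borel" for a
    by (intro borel_measurable_continuous_onI continuous_intros)
  have score_eq: "(\<lambda>x. score M Lh Ch lam x $ a) =
      (\<lambda>x. - (Lh x $ a) - (\<Sum>j\<in>{1..M}. Ch x j $ a * lam j))" for a
    by (simp add: score_def transpose_vec_def)
  have [measurable]: "(\<lambda>x. score M Lh Ch lam x $ a) \<in> borel_measurable P" for a
    unfolding score_eq
    by (intro borel_measurable_diff borel_measurable_uminus borel_measurable_sum
        borel_measurable_times borel_measurable_const
        measurable_compose[OF assms(1) nth] measurable_compose[OF Ch nth])
  have pos: "0 < (\<Sum>b\<in>UNIV. ?e x b)" for x by (intro sum_pos) auto
  have "prob_space (softmax_classifier M \<beta> Lh Ch lam x)" for x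
  proof (rule prob_spaceI)
    have "(\<Sum>a\<in>UNIV. ennreal (?e x a / (\<Sum>b\<in>UNIV. ?e x b))) =
        ennreal (\<Sum>a\<in>UNIV. ?e x a / (\<Sum>b\<in>UNIV. ?e x b))"
      using pos[of x] by (intro sum_ennreal) (auto intro!: divide_nonneg_pos)
    also have "(\<Sum>a\<in>UNIV. ?e x a / (\<Sum>b\<in>UNIV. ?e x b)) = 1"
      using pos[of x] by (simp add: sum_divide_distrib[symmetric])
    finally show "emeasure (softmax_classifier M \<beta> Lh Ch lam x)
        (space (softmax_classifier M \<beta> Lh Ch lam x)) = 1"
      by (simp add: softmax_classifier_def space_point_measure emeasure_point_measure_finite)
  qed
  moreover have "sets (softmax_classifier M \<beta> Lh Ch lam x) = sets (count_space UNIV)" for x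
    by (simp add: softmax_classifier_def sets_point_measure)
  moreover have "(\<lambda>x. emeasure (softmax_classifier M \<beta> Lh Ch lam x) S) \<in> borel_measurable P" for S
    by (simp add: softmax_classifier_def emeasure_point_measure_finite)
  ultimately show ?thesis
    unfolding randomized_prediction_def
    by (intro measurable_prob_algebraI measurable_subprob_algebra)
       (auto intro: prob_space_imp_subprob_space)
qed

end

theory Submission
  imports Defs
begin

text \<open>
  The softmax classifier \<open>\<pi>'\<close> at \<open>\<lambda>\<close> is the entropy-regularised maximiser of the Lagrangian of the
  estimated problem, and the gradient of the dual objective at \<open>\<lambda>\<close> is minus the vector
  \<open>h\<close> of its estimated costs (envelope theorem; here differentiation under the integral sign).
  The gradient mapping \<open>G\<close> is therefore an explicit function of \<open>\<lambda>\<close> and \<open>h\<close>, coordinate by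
  coordinate, and two elementary inequalities about it carry the result:
  \<open>(h\<^sub>j)\<^sub>+ \<le> \<bar>G\<^sub>j\<bar>\<close>, which bounds the violation of the estimated constraints, and
  \<open>- \<lambda>\<^sub>j h\<^sub>j \<le> (\<lambda>\<^sub>j + \<alpha> \<bar>h\<^sub>j\<bar>) \<bar>G\<^sub>j\<bar>\<close>, an approximate complementary slackness.

  For the risk, the Gibbs inequality \<open>softmax_near_optimal\<close> says that at every feature the softmax
  weights maximise the average score up to \<open>ln CARD('a) / \<beta>\<close>. Integrated, it compares the estimated
  Lagrangian of \<open>\<pi>'\<close> with that of any competitor. Complementary slackness removes the
  multiplier term of \<open>\<pi>'\<close>, and feasibility of the competitor removes its own, up to the
  estimation error.

  Passing between true and estimated quantities costs \<open>\<Delta>_constr\<close> or \<open>\<Delta>_loss\<close>, because a vector of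
  probabilities has 1-norm one: its image under a matrix has Euclidean norm at most the
  \<open>1 \<rightarrow> 2\<close> operator norm, and its pairing with a loss vector is at most the maximum norm. Since
  \<open>opnorm_1_2\<close> is the largest Euclidean norm of a column, it is measurable and dominated by
  \<open>opnorm_2_2\<close>, so that the matrix entries are integrable.
\<close>

section \<open>The 1-to-2 operator norm\<close>

lemma L2_set_scale: "L2_set (\<lambda>j. f j * c) A = L2_set f A * \<bar>c\<bar>"
  unfolding L2_set_def
  by (simp add: power_mult_distrib real_sqrt_mult flip: sum_distrib_right)

lemma L2_set_abs: "L2_set (\<lambda>j. \<bar>f j\<bar>) A = L2_set f A"
  by (simp add: L2_set_def)

lemma L2_set_sum_le:
  assumes "finite S"
  shows "L2_set (\<lambda>j. \<Sum>a\<in>S. f a j) A \<le> (\<Sum>a\<in>S. L2_set (f a) A)"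
  using assms
proof (induction S)
  case empty
  then show ?case by (simp add: L2_set_def)
next
  case (insert a S)
  then show ?case
    using L2_set_triangle_ineq[of "f a" "\<lambda>j. \<Sum>a\<in>S. f a j" A] by simp
qed

lemma mult_sum_le_L2_set: "(\<Sum>i\<in>A. f i * g i) \<le> L2_set f A * L2_set g A"
proof -
  have "(\<Sum>i\<in>A. f i * g i) \<le> (\<Sum>i\<in>A. \<bar>f i\<bar> * \<bar>g i\<bar>)"
    by (intro sum_mono) (simp flip: abs_mult)
  then show ?thesis
    using L2_set_mult_ineq[of f g A] by linarith
qed

lemma L2_set_mat_vec_le_columns:
  fixes A :: "nat \<Rightarrow> real ^ 'a"
  shows "L2_set (mat_vec A w) {1..M}
    \<le> (\<Sum>a\<in>UNIV. L2_set (\<lambda>j. A j $ a) {1..M} * \<bar>w $ a\<bar>)"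
  using L2_set_sum_le[of "UNIV :: 'a set" "\<lambda>a j. A j $ a * w $ a" "{1..M}"]
  by (simp add: mat_vec_def L2_set_scale)

lemma mat_vec_axis: "mat_vec A (axis a 1) = (\<lambda>j. A j $ a)"
  by (simp add: mat_vec_def axis_def if_distrib cong: if_cong)

lemma sum_abs_axis: "(\<Sum>b\<in>UNIV. \<bar>axis a (1::real) $ b\<bar>) = 1"
  by (simp add: axis_def if_distrib cong: if_cong)

text \<open>By convexity, the supremum over the unit sphere of the 1-norm is attained at a unit vector.\<close>

lemma opnorm_1_2_eq_Max_columns:
  fixes A :: "nat \<Rightarrow> real ^ 'a"
  shows "opnorm_1_2 M A = Max (range (\<lambda>a. L2_set (\<lambda>j. A j $ a) {1..M}))"
    (is "_ = Max (range ?c)")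
  unfolding opnorm_1_2_def
proof (rule cSup_eq_maximum)
  have "Max (range ?c) \<in> range ?c"
    by (intro Max_in) auto
  then obtain a where "Max (range ?c) = ?c a"
    by blast
  then show "Max (range ?c) \<in> {L2_set (mat_vec A w) {1..M} |w. (\<Sum>a\<in>UNIV. \<bar>w $ a\<bar>) = 1}"
    by (auto intro!: exI[of _ "axis a 1"] simp: mat_vec_axis sum_abs_axis)
next
  fix y
  assume "y \<in> {L2_set (mat_vec A w) {1..M} |w. (\<Sum>a\<in>UNIV. \<bar>w $ a\<bar>) = 1}"
  then obtain w where y: "y = L2_set (mat_vec A w) {1..M}" and w: "(\<Sum>a\<in>UNIV. \<bar>w $ a\<bar>) = 1"
    by auto
  have "y \<le> (\<Sum>a\<in>UNIV. ?c a * \<bar>w $ a\<bar>)"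
    unfolding y by (rule L2_set_mat_vec_le_columns)
  also have "\<dots> \<le> (\<Sum>a\<in>UNIV. Max (range ?c) * \<bar>w $ a\<bar>)"
    by (intro sum_mono mult_right_mono Max_ge) auto
  also have "\<dots> = Max (range ?c)"
    using w by (simp flip: sum_distrib_left)
  finally show "y \<le> Max (range ?c)" .
qed

lemma column_le_opnorm_1_2: "L2_set (\<lambda>j. A j $ a) {1..M} \<le> opnorm_1_2 M A"
  unfolding opnorm_1_2_eq_Max_columns by (intro Max_ge) auto

lemma opnorm_1_2_nonneg: "0 \<le> opnorm_1_2 M A"
  using column_le_opnorm_1_2 L2_set_nonneg order_trans by blast

lemma entry_le_opnorm_1_2:
  assumes "j \<in> {1..M}"
  shows "\<bar>A j $ a\<bar> \<le> opnorm_1_2 M A"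
  using assms member_le_L2_set[of "{1..M}" j "\<lambda>j. \<bar>A j $ a\<bar>"] column_le_opnorm_1_2[where A=A and a=a and M=M]
  by (simp add: L2_set_abs)

lemma L2_set_mat_vec_le_opnorm_1_2:
  assumes "(\<Sum>a\<in>UNIV. \<bar>w $ a\<bar>) = 1"
  shows "L2_set (mat_vec A w) {1..M} \<le> opnorm_1_2 M A"
proof -
  have "L2_set (mat_vec A w) {1..M} \<le> (\<Sum>a\<in>UNIV. opnorm_1_2 M A * \<bar>w $ a\<bar>)"
    by (intro order_trans[OF L2_set_mat_vec_le_columns] sum_mono mult_right_mono
        column_le_opnorm_1_2) auto
  with assms show ?thesis
    by (simp flip: sum_distrib_left)
qed

text \<open>Unit vectors have Euclidean norm one as well, so the largest column also bounds the spectral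
  norm from below; boundedness of the set below makes its supremum meaningful.\<close>

lemma opnorm_1_2_le_opnorm_2_2:
  fixes A :: "nat \<Rightarrow> real ^ 'a"
  shows "opnorm_1_2 M A \<le> opnorm_2_2 M A"
proof -
  let ?S = "{L2_set (mat_vec A w) {1..M} | w. norm w = 1}"
  have "bdd_above ?S"
  proof (rule bdd_aboveI)
    fix y assume "y \<in> ?S"
    then obtain w where y: "y = L2_set (mat_vec A w) {1..M}" and w: "norm w = 1"
      by auto
    have "\<bar>w $ a\<bar> \<le> 1" for a
      using component_le_norm_cart[of w a] w by simp
    then show "y \<le> (\<Sum>a\<in>UNIV. L2_set (\<lambda>j. A j $ a) {1..M} * 1)"
      unfolding y by (intro order_trans[OF L2_set_mat_vec_le_columns] sum_mono mult_left_mono) auto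
  qed
  moreover have "L2_set (\<lambda>j. A j $ a) {1..M} \<in> ?S" for a
    by (auto intro!: exI[of _ "axis a 1"] simp: mat_vec_axis)
  ultimately have "L2_set (\<lambda>j. A j $ a) {1..M} \<le> opnorm_2_2 M A" for a
    unfolding opnorm_2_2_def by (intro cSup_upper)
  then show ?thesis
    unfolding opnorm_1_2_eq_Max_columns by (intro Max.boundedI) auto
qed

lemma borel_measurable_vec_nth_comp:
  fixes f :: "'x \<Rightarrow> real ^ 'a"
  assumes "f \<in> borel_measurable P"
  shows "(\<lambda>x. f x $ a) \<in> borel_measurable P"
  by (rule measurable_compose[OF assms])
    (intro borel_measurable_continuous_onI continuous_intros)

lemma borel_measurable_opnorm_1_2:
  fixes A :: "'x \<Rightarrow> nat \<Rightarrow> real ^ 'a"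
  assumes "\<And>j. j \<in> {1..M} \<Longrightarrow> (\<lambda>x. A x j) \<in> borel_measurable P"
  shows "(\<lambda>x. opnorm_1_2 M (A x)) \<in> borel_measurable P"
proof -
  have "(\<lambda>x. L2_set (\<lambda>j. A x j $ a) {1..M}) \<in> borel_measurable P" for a
    unfolding L2_set_def
    by (intro measurable_compose[OF _ borel_measurable_sqrt] borel_measurable_sum borel_measurable_power
        borel_measurable_vec_nth_comp assms)
  then show ?thesis
    unfolding opnorm_1_2_eq_Max_columns by (intro borel_measurable_Max finite)
qed

lemma integrable_opnorm_1_2:
  fixes A :: "'x \<Rightarrow> nat \<Rightarrow> real ^ 'a"
  assumes "\<And>j. j \<in> {1..M} \<Longrightarrow> (\<lambda>x. A x j) \<in> borel_measurable P"
    and "integrable P (\<lambda>x. opnorm_2_2 M (A x))"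
  shows "integrable P (\<lambda>x. opnorm_1_2 M (A x))"
proof (rule Bochner_Integration.integrable_bound[OF assms(2)])
  have "norm (opnorm_1_2 M (A x)) \<le> norm (opnorm_2_2 M (A x))" for x
    using opnorm_1_2_le_opnorm_2_2[of M "A x"] opnorm_1_2_nonneg[of M "A x"] by simp
  then show "AE x in P. norm (opnorm_1_2 M (A x)) \<le> norm (opnorm_2_2 M (A x))"
    by simp
qed (intro borel_measurable_opnorm_1_2 assms(1))

lemma integrable_matrix_entry:
  fixes A :: "'x \<Rightarrow> nat \<Rightarrow> real ^ 'a"
  assumes "\<And>j. j \<in> {1..M} \<Longrightarrow> (\<lambda>x. A x j) \<in> borel_measurable P"
    and "integrable P (\<lambda>x. opnorm_2_2 M (A x))" and j: "j \<in> {1..M}"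
  shows "integrable P (\<lambda>x. A x j $ a)"
proof (rule Bochner_Integration.integrable_bound[OF integrable_opnorm_1_2[OF assms(1,2)]])
  have "norm (A x j $ a) \<le> norm (opnorm_1_2 M (A x))" for x
    using entry_le_opnorm_1_2[OF j, of "A x" a] by simp
  then show "AE x in P. norm (A x j $ a) \<le> norm (opnorm_1_2 M (A x))"
    by simp
  show "(\<lambda>x. A x j $ a) \<in> borel_measurable P"
    by (intro borel_measurable_vec_nth_comp assms(1) j)
qed

lemma integrable_vec_nth:
  fixes f :: "'x \<Rightarrow> real ^ 'a"
  assumes "f \<in> borel_measurable P" and "integrable P (\<lambda>x. norm (f x))"
  shows "integrable P (\<lambda>x. f x $ a)"
  by (rule Bochner_Integration.integrable_bound[OF assms(2)])
    (auto simp: component_le_norm_cart intro!: borel_measurable_vec_nth_comp assms(1))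

section \<open>Integrals\<close>

text \<open>Jensen's inequality for the Euclidean norm of an integral. With \<open>h\<close> the integrated vector, it
  follows by integrating the Cauchy-Schwarz bound on the inner product of \<open>h\<close> with \<open>v x\<close>.\<close>

lemma L2_set_integral_le:
  fixes v :: "'x \<Rightarrow> nat \<Rightarrow> real"
  assumes "\<And>j. j \<in> A \<Longrightarrow> integrable P (\<lambda>x. v x j)"
    and "integrable P g" and "\<And>x. x \<in> space P \<Longrightarrow> L2_set (v x) A \<le> g x"
  shows "L2_set (\<lambda>j. \<integral>x. v x j \<partial>P) A \<le> (\<integral>x. g x \<partial>P)"
proof -
  define h where "h = (\<lambda>j. \<integral>x. v x j \<partial>P)"
  have "L2_set h A * L2_set h A = (\<Sum>j\<in>A. h j * h j)"
    by (simp add: L2_set_def sum_nonneg power2_eq_square)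
  also have "\<dots> = (\<Sum>j\<in>A. \<integral>x. h j * v x j \<partial>P)"
    by (simp add: h_def)
  also have "\<dots> = (\<integral>x. (\<Sum>j\<in>A. h j * v x j) \<partial>P)"
    using assms(1) by (intro Bochner_Integration.integral_sum[symmetric]) auto
  also have "\<dots> \<le> (\<integral>x. L2_set h A * g x \<partial>P)"
  proof (rule integral_mono)
    show "(\<Sum>j\<in>A. h j * v x j) \<le> L2_set h A * g x" if "x \<in> space P" for x
      using that
      by (intro order_trans[OF mult_sum_le_L2_set] mult_left_mono assms(3)) simp_all
  qed (use assms in auto)
  also have "\<dots> = L2_set h A * (\<integral>x. g x \<partial>P)"
    by simp
  finally have *: "L2_set h A * L2_set h A \<le> L2_set h A * (\<integral>x. g x \<partial>P)" .
  have "0 \<le> g x" if "x \<in> space P" for x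
    using assms(3)[OF that] L2_set_nonneg[of "v x" A] by linarith
  then have "0 \<le> (\<integral>x. g x \<partial>P)"
    by (intro integral_nonneg_AE) auto
  with * show ?thesis
    unfolding h_def[symmetric] using L2_set_nonneg[of h A]
    by (cases "L2_set h A = 0") (auto simp: mult_le_cancel_left)
qed

lemma (in prob_space) expectation_le_sqrt_second_moment:
  fixes f :: "'a \<Rightarrow> real"
  assumes "f \<in> borel_measurable M" and "integrable M (\<lambda>x. (f x)\<^sup>2)"
  shows "expectation f \<le> sqrt (expectation (\<lambda>x. (f x)\<^sup>2))"
proof -
  have "integrable M f"
    using assms by (rule square_integrable_imp_integrable)
  then have "(expectation f)\<^sup>2 \<le> expectation (\<lambda>x. (f x)\<^sup>2)"
    using variance_eq[of f] variance_positive[of f] assms(2) by simp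
  then show ?thesis
    by (rule real_le_rsqrt)
qed

text \<open>Differentiation under the integral sign: the mean value theorem bounds all difference quotients
  by \<open>w\<close>, so dominated convergence applies to them.\<close>

lemma has_real_derivative_integral:
  fixes f f' :: "'x \<Rightarrow> real \<Rightarrow> real"
  assumes int: "\<And>t. integrable P (\<lambda>x. f x t)"
    and deriv: "\<And>x t. (f x has_real_derivative f' x t) (at t)"
    and bound: "\<And>x t. \<bar>f' x t\<bar> \<le> w x" and w: "integrable P w"
    and meas: "(\<lambda>x. f' x t0) \<in> borel_measurable P"
  shows "((\<lambda>t. \<integral>x. f x t \<partial>P) has_real_derivative (\<integral>x. f' x t0 \<partial>P)) (at t0)"
  unfolding has_field_derivative_iff tendsto_at_iff_sequentially comp_def
proof (intro allI impI)
  fix X :: "nat \<Rightarrow> real"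
  assume X: "\<forall>i. X i \<in> UNIV - {t0}" and lim: "X \<longlonglongrightarrow> t0"
  have "(\<lambda>n. \<integral>x. (f x (X n) - f x t0) / (X n - t0) \<partial>P) \<longlonglongrightarrow> (\<integral>x. f' x t0 \<partial>P)"
  proof (rule integral_dominated_convergence[where w = w])
    show "(\<lambda>x. f' x t0) \<in> borel_measurable P" "integrable P w"
      by fact+
    show "(\<lambda>x. (f x (X n) - f x t0) / (X n - t0)) \<in> borel_measurable P" for n
      using borel_measurable_integrable[OF int]
      by (intro borel_measurable_divide borel_measurable_diff borel_measurable_const)
    show "AE x in P. (\<lambda>n. (f x (X n) - f x t0) / (X n - t0)) \<longlonglongrightarrow> f' x t0"
      using deriv[of _ t0] X lim
      unfolding has_field_derivative_iff tendsto_at_iff_sequentially comp_def by auto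
    have "norm ((f x (X n) - f x t0) / (X n - t0)) \<le> w x" for x n
    proof -
      have "norm (f x (X n) - f x t0) \<le> w x * norm (X n - t0)"
        by (rule field_differentiable_bound[of UNIV "f x" "f' x"])
          (use deriv bound in auto)
      then show ?thesis
        using X by (simp add: divide_simps)
    qed
    then show "AE x in P. norm ((f x (X n) - f x t0) / (X n - t0)) \<le> w x" for n
      by simp
  qed
  moreover have "(\<integral>x. (f x (X n) - f x t0) / (X n - t0) \<partial>P) =
      ((\<integral>x. f x (X n) \<partial>P) - (\<integral>x. f x t0 \<partial>P)) / (X n - t0)" for n
    by (simp only: Bochner_Integration.integral_diff[OF int int] integral_divide_zero)
  ultimately show "(\<lambda>n. ((\<integral>x. f x (X n) \<partial>P) - (\<integral>x. f x t0 \<partial>P)) / (X n - t0))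
      \<longlonglongrightarrow> (\<integral>x. f' x t0 \<partial>P)"
    by (simp only:)
qed

section \<open>Randomized predictions as probability vectors\<close>

definition pred_probs :: "('x \<Rightarrow> 'a::finite measure) \<Rightarrow> 'x \<Rightarrow> real ^ 'a" where
  "pred_probs \<pi> x = (\<chi> a. measure (\<pi> x) {a})"

lemma sum_pred_probs:
  fixes \<pi> :: "'x \<Rightarrow> 'a::finite measure"
  assumes "randomized_prediction P \<pi>" and "x \<in> space P"
  shows "(\<Sum>a\<in>UNIV. measure (\<pi> x) {a}) = 1"
proof -
  have "\<pi> x \<in> space (prob_algebra (count_space UNIV))"
    using assms measurable_space unfolding randomized_prediction_def by fast
  then interpret prob_space "\<pi> x"
    by (simp add: space_prob_algebra)
  have sets: "sets (\<pi> x) = UNIV"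
    using \<open>\<pi> x \<in> _\<close> by (auto simp: space_prob_algebra)
  then have "space (\<pi> x) = UNIV"
    using sets.sets_into_space by (metis UNIV_I subset_UNIV subset_antisym)
  then show ?thesis
    using finite_measure_finite_Union[of UNIV "\<lambda>a. {a}"] sets prob_space
    by (auto simp: disjoint_family_on_def)
qed

lemma borel_measurable_pred_probs:
  fixes \<pi> :: "'x \<Rightarrow> 'a::finite measure"
  assumes "randomized_prediction P \<pi>"
  shows "(\<lambda>x. measure (\<pi> x) {a}) \<in> borel_measurable P"
proof -
  have "\<pi> \<in> P \<rightarrow>\<^sub>M subprob_algebra (count_space UNIV)"
    using assms unfolding randomized_prediction_def by (rule measurable_prob_algebraD)
  then show ?thesis
    by (rule measurable_compose) (rule measurable_measure_subprob_algebra, simp)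
qed

lemma integrable_predicted_mean:
  fixes f :: "'x \<Rightarrow> real ^ 'a"
  assumes \<pi>: "randomized_prediction P \<pi>" and f: "\<And>a. integrable P (\<lambda>x. f x $ a)"
  shows "integrable P (\<lambda>x. \<Sum>a\<in>UNIV. f x $ a * measure (\<pi> x) {a})"
proof (intro Bochner_Integration.integrable_sum)
  fix a :: 'a
  show "integrable P (\<lambda>x. f x $ a * measure (\<pi> x) {a})"
  proof (rule Bochner_Integration.integrable_bound[OF f[of a]])
    show "(\<lambda>x. f x $ a * measure (\<pi> x) {a}) \<in> borel_measurable P"
      using borel_measurable_integrable[OF f[of a]] borel_measurable_pred_probs[OF \<pi>, of a]
      by (rule borel_measurable_times)
    have "norm (f x $ a * measure (\<pi> x) {a}) \<le> norm (f x $ a)" if "x \<in> space P" for x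
    proof -
      have "measure (\<pi> x) {a} \<le> (\<Sum>a\<in>UNIV. measure (\<pi> x) {a})"
        by (rule member_le_sum) auto
      then show ?thesis
        using sum_pred_probs[OF \<pi> that] by (simp add: abs_mult mult_left_le)
    qed
    then show "AE x in P. norm (f x $ a * measure (\<pi> x) {a}) \<le> norm (f x $ a)"
      by (intro AE_I2)
  qed
qed

text \<open>A randomized prediction averages the columns of a matrix, at every feature. The norm
  of the result is at most that of the largest column, and Jensen's inequality carries this bound
  over to the expected costs.\<close>

lemma L2_set_predicted_mean_le:
  fixes A :: "'x \<Rightarrow> nat \<Rightarrow> real ^ 'a"
  assumes \<pi>: "randomized_prediction P \<pi>"
    and entries: "\<And>j a. j \<in> {1..M} \<Longrightarrow> integrable P (\<lambda>x. A x j $ a)"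
    and norm: "integrable P (\<lambda>x. opnorm_1_2 M (A x))"
  shows "L2_set (\<lambda>j. cost P A j \<pi>) {1..M} \<le> (\<integral>x. opnorm_1_2 M (A x) \<partial>P)"
proof -
  have cost_eq: "cost P A j \<pi> = (\<integral>x. mat_vec (A x) (pred_probs \<pi> x) j \<partial>P)" for j
    by (simp add: cost_def mat_vec_def pred_probs_def)
  show ?thesis
    unfolding cost_eq
  proof (rule L2_set_integral_le[OF _ norm])
    show "integrable P (\<lambda>x. mat_vec (A x) (pred_probs \<pi> x) j)" if "j \<in> {1..M}" for j
      using integrable_predicted_mean[OF \<pi> entries[OF that]]
      by (simp add: mat_vec_def pred_probs_def)
    show "L2_set (mat_vec (A x) (pred_probs \<pi> x)) {1..M} \<le> opnorm_1_2 M (A x)"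
      if "x \<in> space P" for x
      using sum_pred_probs[OF \<pi> that]
      by (intro L2_set_mat_vec_le_opnorm_1_2) (simp add: pred_probs_def)
  qed
qed

lemma cost_diff:
  fixes A B :: "'x \<Rightarrow> nat \<Rightarrow> real ^ 'a"
  assumes "randomized_prediction P \<pi>"
    and "\<And>a. integrable P (\<lambda>x. A x j $ a)" and "\<And>a. integrable P (\<lambda>x. B x j $ a)"
  shows "cost P (\<lambda>x j. A x j - B x j) j \<pi> = cost P A j \<pi> - cost P B j \<pi>"
  using integrable_predicted_mean[OF assms(1,2)] integrable_predicted_mean[OF assms(1,3)]
  unfolding cost_def
  by (subst Bochner_Integration.integral_diff[symmetric])
    (simp_all add: left_diff_distrib sum_subtractf)

lemma L2_set_cost_diff_le:
  fixes A B :: "'x \<Rightarrow> nat \<Rightarrow> real ^ 'a"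
  assumes "prob_space P" and \<pi>: "randomized_prediction P \<pi>"
    and A: "\<And>j a. j \<in> {1..M} \<Longrightarrow> integrable P (\<lambda>x. A x j $ a)"
    and B: "\<And>j a. j \<in> {1..M} \<Longrightarrow> integrable P (\<lambda>x. B x j $ a)"
    and meas: "(\<lambda>x. opnorm_1_2 M (\<lambda>j. A x j - B x j)) \<in> borel_measurable P"
    and sq: "integrable P (\<lambda>x. (opnorm_1_2 M (\<lambda>j. A x j - B x j))\<^sup>2)"
  shows "L2_set (\<lambda>j. cost P A j \<pi> - cost P B j \<pi>) {1..M} \<le> \<Delta>_constr P M A B"
proof -
  interpret prob_space P by fact
  have "L2_set (\<lambda>j. cost P A j \<pi> - cost P B j \<pi>) {1..M} =
      L2_set (\<lambda>j. cost P (\<lambda>x j. A x j - B x j) j \<pi>) {1..M}"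
    using A B by (intro L2_set_cong) (auto simp: cost_diff[OF \<pi>])
  also have "\<dots> \<le> (\<integral>x. opnorm_1_2 M (\<lambda>j. A x j - B x j) \<partial>P)"
    using A B by (intro L2_set_predicted_mean_le[OF \<pi>]
        square_integrable_imp_integrable[OF meas sq]) auto
  also have "\<dots> \<le> \<Delta>_constr P M A B"
    unfolding \<Delta>_constr_def by (rule expectation_le_sqrt_second_moment[OF meas sq])
  finally show ?thesis .
qed

lemma risk_diff_le:
  fixes L Lh :: "'x \<Rightarrow> real ^ 'a"
  assumes \<pi>: "randomized_prediction P \<pi>"
    and "L \<in> borel_measurable P" and "Lh \<in> borel_measurable P"
    and "integrable P (\<lambda>x. norm (L x))" and "integrable P (\<lambda>x. norm (Lh x))"
  shows "\<bar>risk P L \<pi> - risk P Lh \<pi>\<bar> \<le> \<Delta>_loss P L Lh"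
proof -
  let ?m = "\<lambda>f x. \<Sum>a\<in>UNIV. f x $ a * measure (\<pi> x) {a}"
  have L: "integrable P (?m L)" and Lh: "integrable P (?m Lh)"
    using assms by (auto intro!: integrable_predicted_mean integrable_vec_nth)
  have int: "integrable P (\<lambda>x. infnorm (L x - Lh x))"
  proof (rule Bochner_Integration.integrable_bound)
    show "integrable P (\<lambda>x. norm (L x) + norm (Lh x))"
      using assms by auto
    have "infnorm \<in> borel_measurable (borel :: (real ^ 'a) measure)"
      by (intro borel_measurable_continuous_onI continuous_at_imp_continuous_on ballI
          continuous_infnorm continuous_ident)
    then show "(\<lambda>x. infnorm (L x - Lh x)) \<in> borel_measurable P"
      using assms(2,3) by measurable
    have "norm (infnorm (L x - Lh x)) \<le> norm (norm (L x) + norm (Lh x))" for x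
      using infnorm_le_norm[of "L x - Lh x"] norm_triangle_ineq4[of "L x" "Lh x"]
      by (simp add: infnorm_pos_le)
    then show "AE x in P. norm (infnorm (L x - Lh x)) \<le> norm (norm (L x) + norm (Lh x))"
      by simp
  qed
  have "\<bar>risk P L \<pi> - risk P Lh \<pi>\<bar> = \<bar>\<integral>x. ?m L x - ?m Lh x \<partial>P\<bar>"
    using L Lh by (simp add: risk_def)
  also have "\<dots> \<le> (\<integral>x. \<bar>?m L x - ?m Lh x\<bar> \<partial>P)"
    by (rule integral_abs_bound)
  also have "\<dots> \<le> \<Delta>_loss P L Lh"
    unfolding \<Delta>_loss_def
  proof (rule integral_mono[OF _ int])
    fix x assume x: "x \<in> space P"
    have "\<bar>?m L x - ?m Lh x\<bar> = \<bar>\<Sum>a\<in>UNIV. (L x - Lh x) $ a * measure (\<pi> x) {a}\<bar>"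
      by (simp add: left_diff_distrib sum_subtractf)
    also have "\<dots> \<le> (\<Sum>a\<in>UNIV. infnorm (L x - Lh x) * measure (\<pi> x) {a})"
      by (intro order_trans[OF sum_abs] sum_mono)
        (auto simp del: vector_minus_component
          simp: abs_mult intro!: mult_right_mono component_le_infnorm_cart)
    also have "\<dots> = infnorm (L x - Lh x)"
      using sum_pred_probs[OF \<pi> x] by (simp flip: sum_distrib_left)
    finally show "\<bar>?m L x - ?m Lh x\<bar> \<le> infnorm (L x - Lh x)" .
  qed (use L Lh in auto)
  finally show ?thesis .
qed

section \<open>Softmax weights and the dual gradient\<close>

lemma sum_exp_pos: "0 < (\<Sum>b\<in>(UNIV::'a::finite set). exp (f b :: real))"
  by (intro sum_pos) auto

lemma component_le_LSE:
  fixes w :: "real ^ 'a"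
  assumes "\<beta> > 0"
  shows "w $ a \<le> LSE \<beta> w"
proof -
  have "exp (\<beta> * w $ a) \<le> (\<Sum>b\<in>UNIV. exp (\<beta> * w $ b))"
    by (rule member_le_sum) auto
  then have "\<beta> * w $ a \<le> ln (\<Sum>b\<in>UNIV. exp (\<beta> * w $ b))"
    using sum_exp_pos by (subst ln_ge_iff) auto
  with assms show ?thesis
    by (simp add: LSE_def field_simps)
qed

lemma abs_LSE_le:
  fixes w :: "real ^ 'a"
  assumes "\<beta> > 0"
  shows "\<bar>LSE \<beta> w\<bar> \<le> (\<Sum>a\<in>UNIV. \<bar>w $ a\<bar>) + ln (real CARD('a)) / \<beta>"
proof -
  let ?s = "\<Sum>a\<in>UNIV. \<bar>w $ a\<bar>"
  have s: "\<bar>w $ a\<bar> \<le> ?s" for a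
    by (rule member_le_sum) auto
  have "(\<Sum>b\<in>UNIV. exp (\<beta> * w $ b)) \<le> (\<Sum>b\<in>(UNIV::'a set). exp (\<beta> * ?s))"
    using assms by (intro sum_mono) (auto intro!: mult_left_mono order_trans[OF abs_ge_self s])
  then have "ln (\<Sum>b\<in>UNIV. exp (\<beta> * w $ b)) \<le> ln (real CARD('a) * exp (\<beta> * ?s))"
    by (subst ln_le_cancel_iff) (simp_all add: sum_exp_pos)
  then have "LSE \<beta> w \<le> ?s + ln (real CARD('a)) / \<beta>"
    using assms by (simp add: LSE_def field_simps ln_mult)
  moreover have "- ?s \<le> LSE \<beta> w"
    using component_le_LSE[OF assms, of w undefined] s[of undefined] by linarith
  moreover have "0 \<le> ln (real CARD('a)) / \<beta>"
    using assms by (simp add: Suc_leI)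
  ultimately show ?thesis
    by linarith
qed

text \<open>The gap between the log-sum-exp and the softmax average is the entropy of the softmax weights
  divided by \<open>\<beta>\<close>, and entropy is at most \<open>ln CARD('a)\<close>. The tangent bound
  \<open>1 - 1 / y \<le> ln y\<close>, at \<open>y = CARD('a) * p\<close>, replaces Jensen's inequality here.\<close>

lemma softmax_near_optimal:
  fixes w q :: "real ^ 'a"
  assumes \<beta>: "\<beta> > 0" and q: "\<And>a. 0 \<le> q $ a" "(\<Sum>a\<in>UNIV. q $ a) = 1"
  shows "(\<Sum>a\<in>UNIV. w $ a * q $ a) \<le>
    (\<Sum>a\<in>UNIV. w $ a * (exp (\<beta> * w $ a) / (\<Sum>b\<in>UNIV. exp (\<beta> * w $ b))))
      + ln (real CARD('a)) / \<beta>"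
proof -
  let ?Z = "\<Sum>b\<in>UNIV. exp (\<beta> * w $ b)"
  let ?p = "\<lambda>a. exp (\<beta> * w $ a) / ?Z"
  let ?n = "real CARD('a)"
  have Z: "?Z > 0"
    by (rule sum_exp_pos)
  have p: "?p a > 0" for a
    using Z by simp
  have sum_p: "(\<Sum>a\<in>UNIV. ?p a) = 1"
    using Z by (simp flip: sum_divide_distrib)
  have w_eq: "\<beta> * w $ a = ln (?p a) + ln ?Z" for a
    using Z by (simp add: ln_div)
  have "?p a - 1 / ?n \<le> ?p a * (ln ?n + ln (?p a))" for a
  proof -
    have "1 - inverse y \<le> ln y" if "y > 0" for y :: real
      using ln_le_minus_one[of "inverse y"] that by (simp add: ln_inverse)
    moreover have "?n * ?p a > 0"
      using p[of a] by (intro mult_pos_pos) auto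
    ultimately have "1 - inverse (?n * ?p a) \<le> ln (?n * ?p a)"
      by blast
    then have "?p a * (1 - inverse (?n * ?p a)) \<le> ?p a * ln (?n * ?p a)"
      using p[of a] by (intro mult_left_mono) auto
    also have "?p a * (1 - inverse (?n * ?p a)) = ?p a - 1 / ?n"
      using p[of a] Z by (simp add: field_simps)
    also have "ln (?n * ?p a) = ln ?n + ln (?p a)"
      using p[of a] by (intro ln_mult_pos) auto
    finally show ?thesis .
  qed
  then have "(\<Sum>a\<in>UNIV. ?p a - 1 / ?n) \<le> (\<Sum>a\<in>UNIV. ?p a * (ln ?n + ln (?p a)))"
    by (rule sum_mono)
  then have "0 \<le> ln ?n + (\<Sum>a\<in>UNIV. ?p a * ln (?p a))"
    by (simp only: sum_subtractf sum_p distrib_left sum.distrib flip: sum_distrib_right) simp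
  moreover have "\<beta> * (\<Sum>a\<in>UNIV. w $ a * ?p a) = (\<Sum>a\<in>UNIV. ?p a * ln (?p a)) + ln ?Z"
  proof -
    have "\<beta> * (\<Sum>a\<in>UNIV. w $ a * ?p a) = (\<Sum>a\<in>UNIV. ?p a * (ln (?p a) + ln ?Z))"
      by (simp only: w_eq[symmetric] sum_distrib_left) (simp add: mult_ac)
    also have "\<dots> = (\<Sum>a\<in>UNIV. ?p a * ln (?p a)) + ln ?Z"
      by (simp only: distrib_left sum.distrib sum_p mult_1 flip: sum_distrib_right)
    finally show ?thesis .
  qed
  ultimately have "ln ?Z \<le> \<beta> * (\<Sum>a\<in>UNIV. w $ a * ?p a) + ln ?n"
    by linarith
  then have "LSE \<beta> w \<le> (\<Sum>a\<in>UNIV. w $ a * ?p a) + ln ?n / \<beta>"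
    using \<beta> by (simp add: LSE_def field_simps)
  moreover have "(\<Sum>a\<in>UNIV. w $ a * q $ a) \<le> (\<Sum>a\<in>UNIV. LSE \<beta> w * q $ a)"
    by (intro sum_mono mult_right_mono component_le_LSE \<beta> q)
  then have "(\<Sum>a\<in>UNIV. w $ a * q $ a) \<le> LSE \<beta> w"
    using q(2) by (simp flip: sum_distrib_left)
  ultimately show ?thesis
    by linarith
qed

lemma score_fun_upd:
  assumes "j \<in> {1..M}"
  shows "score M L C (lam(j := t)) x $ a =
    score M L C (lam(j := 0)) x $ a - C x j $ a * t"
proof -
  have "(\<Sum>i\<in>{1..M}. C x i $ a * (lam(j := u)) i) =
      C x j $ a * u + (\<Sum>i\<in>{1..M} - {j}. C x i $ a * lam i)" for u
    by (subst sum.remove[OF _ assms]) auto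
  then show ?thesis
    by (simp only: score_def transpose_vec_def vector_minus_component vec_lambda_beta)
qed

lemma integrable_score:
  assumes "\<And>a. integrable P (\<lambda>x. L x $ a)"
    and "\<And>j a. j \<in> {1..M} \<Longrightarrow> integrable P (\<lambda>x. C x j $ a)"
  shows "integrable P (\<lambda>x. score M L C lam x $ a)"
  using assms unfolding score_def transpose_vec_def
  by (simp only: vector_minus_component vector_uminus_component vec_lambda_beta)
    (intro Bochner_Integration.integrable_diff integrable_minus
      Bochner_Integration.integrable_sum integrable_mult_left)

text \<open>Moving a multiplier by \<open>t\<close> shifts every score linearly, so the derivative of log-sum-exp is
  the softmax average of these slopes; as an average, it is bounded in terms of the slopes alone,
  uniformly in the multiplier, which is the domination needed to differentiate under the integral.\<close>

lemma grad_dual_objective: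
  fixes Lh :: "'x \<Rightarrow> real ^ 'a" and Ch :: "'x \<Rightarrow> nat \<Rightarrow> real ^ 'a"
  assumes "prob_space P" and \<beta>: "\<beta> > 0" and j: "j \<in> {1..M}"
    and Lh: "\<And>a. integrable P (\<lambda>x. Lh x $ a)"
    and Ch: "\<And>j a. j \<in> {1..M} \<Longrightarrow> integrable P (\<lambda>x. Ch x j $ a)"
    and \<pi>: "randomized_prediction P (softmax_classifier M \<beta> Lh Ch lam)"
  shows "grad (dual_objective P M \<beta> Lh Ch) lam j
    = - cost P Ch j (softmax_classifier M \<beta> Lh Ch lam)"
proof -
  interpret prob_space P by fact
  define s where "s = (\<lambda>x t a. score M Lh Ch (lam(j := t)) x $ a)"
  define Z where "Z = (\<lambda>x t. \<Sum>b\<in>UNIV. exp (\<beta> * s x t b))"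
  define D where "D = (\<lambda>x t. - (\<Sum>a\<in>UNIV. Ch x j $ a * (exp (\<beta> * s x t a) / Z x t)))"
  have Z: "Z x t > 0" for x t
    unfolding Z_def by (rule sum_exp_pos)
  have s_deriv: "((\<lambda>t. s x t a) has_real_derivative - (Ch x j $ a)) (at t)" for x t a
  proof -
    have "(\<lambda>t. s x t a) = (\<lambda>t. s x 0 a - Ch x j $ a * t)"
      unfolding s_def by (intro ext score_fun_upd[OF j])
    moreover have "((\<lambda>t. s x 0 a - Ch x j $ a * t) has_real_derivative - (Ch x j $ a)) (at t)"
      by (auto intro!: derivative_eq_intros)
    ultimately show ?thesis
      by (simp only:)
  qed
  have "((\<lambda>t. \<integral>x. LSE \<beta> (score M Lh Ch (lam(j := t)) x) \<partial>P) has_real_derivative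
      (\<integral>x. D x (lam j) \<partial>P)) (at (lam j))"
  proof (rule has_real_derivative_integral[where w = "\<lambda>x. \<Sum>a\<in>UNIV. \<bar>Ch x j $ a\<bar>"])
    show "integrable P (\<lambda>x. LSE \<beta> (score M Lh Ch (lam(j := t)) x))" for t
    proof (rule Bochner_Integration.integrable_bound)
      have score: "integrable P (\<lambda>x. score M Lh Ch (lam(j := t)) x $ a)" for a
        by (rule integrable_score[OF Lh Ch])
      then show "integrable P (\<lambda>x. (\<Sum>a\<in>UNIV. \<bar>score M Lh Ch (lam(j := t)) x $ a\<bar>)
          + ln (real CARD('a)) / \<beta>)"
        by auto
      show "(\<lambda>x. LSE \<beta> (score M Lh Ch (lam(j := t)) x)) \<in> borel_measurable P"
        unfolding LSE_def using borel_measurable_integrable[OF score] by measurable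
      show "AE x in P. norm (LSE \<beta> (score M Lh Ch (lam(j := t)) x)) \<le>
          norm ((\<Sum>a\<in>UNIV. \<bar>score M Lh Ch (lam(j := t)) x $ a\<bar>) + ln (real CARD('a)) / \<beta>)"
        using abs_LSE_le[OF \<beta>] by (auto intro!: order_trans[OF _ abs_ge_self])
    qed
    show "((\<lambda>t. LSE \<beta> (score M Lh Ch (lam(j := t)) x)) has_real_derivative D x t) (at t)" for x t
    proof -
      have "((\<lambda>t. ln (Z x t) / \<beta>) has_real_derivative
          (\<Sum>b\<in>UNIV. exp (\<beta> * s x t b) * (\<beta> * - (Ch x j $ b))) / Z x t / \<beta>) (at t)"
        using Z[of x t] \<beta> unfolding Z_def
        by (auto intro!: derivative_eq_intros s_deriv simp: divide_simps mult_ac)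
      also have "(\<Sum>b\<in>UNIV. exp (\<beta> * s x t b) * (\<beta> * - (Ch x j $ b))) / Z x t / \<beta> = D x t"
        using \<beta> by (simp add: D_def sum_divide_distrib sum_negf mult_ac)
      finally show ?thesis
        unfolding LSE_def Z_def s_def .
    qed
    show "\<bar>D x t\<bar> \<le> (\<Sum>a\<in>UNIV. \<bar>Ch x j $ a\<bar>)" for x t
    proof -
      have "exp (\<beta> * s x t a) \<le> Z x t" for a
        unfolding Z_def by (rule member_le_sum) auto
      then have "\<bar>exp (\<beta> * s x t a) / Z x t\<bar> \<le> 1" for a
        using Z[of x t] by (simp add: divide_simps)
      then show ?thesis
        unfolding D_def abs_minus_cancel
        by (intro order_trans[OF sum_abs] sum_mono) (simp only: abs_mult mult_left_le abs_ge_zero)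
    qed
    show "integrable P (\<lambda>x. \<Sum>a\<in>UNIV. \<bar>Ch x j $ a\<bar>)"
      using Ch[OF j] by auto
    show "(\<lambda>x. D x (lam j)) \<in> borel_measurable P"
      using borel_measurable_integrable[OF integrable_predicted_mean[OF \<pi> Ch[OF j]]]
      by (simp add: D_def Z_def s_def measure_softmax_classifier)
  qed
  also have "(\<integral>x. D x (lam j) \<partial>P) = - cost P Ch j (softmax_classifier M \<beta> Lh Ch lam)"
    by (simp add: D_def Z_def s_def measure_softmax_classifier cost_def)
  finally show ?thesis
    unfolding grad_def dual_objective_def by (rule DERIV_imp_deriv)
qed

text \<open>Exchanging the order of summation in the pairing of the scores with a weight vector exhibits
  it as minus the Lagrangian.\<close>

lemma sum_score_mult:
  "(\<Sum>a\<in>UNIV. score M L C lam x $ a * q a) =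
    - (\<Sum>a\<in>UNIV. L x $ a * q a) - (\<Sum>j\<in>{1..M}. lam j * (\<Sum>a\<in>UNIV. C x j $ a * q a))"
proof -
  have "(\<Sum>a\<in>UNIV. (\<Sum>j\<in>{1..M}. C x j $ a * lam j) * q a) =
      (\<Sum>j\<in>{1..M}. lam j * (\<Sum>a\<in>UNIV. C x j $ a * q a))"
    unfolding sum_distrib_left sum_distrib_right
    by (subst sum.swap) (simp add: mult_ac)
  then show ?thesis
    by (simp add: score_def transpose_vec_def left_diff_distrib sum_subtractf sum_negf)
qed

lemma softmax_lagrangian_le:
  fixes Lh :: "'x \<Rightarrow> real ^ 'a" and Ch :: "'x \<Rightarrow> nat \<Rightarrow> real ^ 'a"
  assumes "prob_space P" and \<beta>: "\<beta> > 0"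
    and Lh: "\<And>a. integrable P (\<lambda>x. Lh x $ a)"
    and Ch: "\<And>j a. j \<in> {1..M} \<Longrightarrow> integrable P (\<lambda>x. Ch x j $ a)"
    and soft: "randomized_prediction P (softmax_classifier M \<beta> Lh Ch lam)"
    and \<pi>: "randomized_prediction P \<pi>"
  shows "risk P Lh (softmax_classifier M \<beta> Lh Ch lam)
      + (\<Sum>j\<in>{1..M}. lam j * cost P Ch j (softmax_classifier M \<beta> Lh Ch lam))
    \<le> risk P Lh \<pi> + (\<Sum>j\<in>{1..M}. lam j * cost P Ch j \<pi>) + ln (real CARD('a)) / \<beta>"
proof -
  interpret prob_space P by fact
  define lagr where "lagr = (\<lambda>\<rho> x. (\<Sum>a\<in>UNIV. Lh x $ a * measure (\<rho> x :: 'a measure) {a})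
      + (\<Sum>j\<in>{1..M}. lam j * (\<Sum>a\<in>UNIV. Ch x j $ a * measure (\<rho> x) {a})))"
  have int: "integrable P (lagr \<rho>)"
    and eq: "(\<integral>x. lagr \<rho> x \<partial>P) = risk P Lh \<rho> + (\<Sum>j\<in>{1..M}. lam j * cost P Ch j \<rho>)"
    if "randomized_prediction P \<rho>" for \<rho>
  proof -
    have L: "integrable P (\<lambda>x. \<Sum>a\<in>UNIV. Lh x $ a * measure (\<rho> x) {a})"
      by (rule integrable_predicted_mean[OF that Lh])
    have C: "integrable P (\<lambda>x. lam j * (\<Sum>a\<in>UNIV. Ch x j $ a * measure (\<rho> x) {a}))"
      if "j \<in> {1..M}" for j
      using integrable_predicted_mean[OF \<open>randomized_prediction P \<rho>\<close> Ch[OF that]]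
      by (rule integrable_mult_right)
    show "integrable P (lagr \<rho>)"
      unfolding lagr_def
      by (intro Bochner_Integration.integrable_add Bochner_Integration.integrable_sum L C)
    show "(\<integral>x. lagr \<rho> x \<partial>P) = risk P Lh \<rho> + (\<Sum>j\<in>{1..M}. lam j * cost P Ch j \<rho>)"
      unfolding lagr_def risk_def cost_def
      by (subst Bochner_Integration.integral_add[OF L Bochner_Integration.integrable_sum[OF C]],
          assumption, subst Bochner_Integration.integral_sum[OF C], assumption) simp
  qed
  have "(\<integral>x. lagr (softmax_classifier M \<beta> Lh Ch lam) x \<partial>P) \<le>
      (\<integral>x. lagr \<pi> x + ln (real CARD('a)) / \<beta> \<partial>P)"
  proof (rule integral_mono)
    fix x assume x: "x \<in> space P"
    show "lagr (softmax_classifier M \<beta> Lh Ch lam) x \<le> lagr \<pi> x + ln (real CARD('a)) / \<beta>"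
      using softmax_near_optimal[OF \<beta>, of "pred_probs \<pi> x" "score M Lh Ch lam x"]
        sum_pred_probs[OF \<pi> x]
      by (simp add: lagr_def pred_probs_def sum_score_mult flip: measure_softmax_classifier)
  qed (use int[OF soft] int[OF \<pi>] in auto)
  then show ?thesis
    using int[OF \<pi>] by (simp add: eq[OF soft] eq[OF \<pi>] prob_space)
qed

section \<open>The gradient mapping\<close>

lemma pos_part_le_gradient_mapping:
  fixes l h \<alpha> :: real
  assumes "\<alpha> > 0" and "l \<ge> 0"
  shows "max h 0 \<le> \<bar>(1 / \<alpha>) * (l - max (l + \<alpha> * h) 0)\<bar>"
proof (cases "h \<le> 0")
  case False
  with assms have "l + \<alpha> * h > 0"
    by (simp add: add_nonneg_pos)
  with assms show ?thesis by simp
qed simp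

text \<open>If the projection is inactive, then the gradient mapping is \<open>- h\<close>; otherwise it is \<open>l / \<alpha>\<close>
  with \<open>h\<close> negative. The two summands on the right serve these two cases in turn.\<close>

lemma approximate_complementary_slackness:
  fixes l h \<alpha> :: real
  assumes "\<alpha> > 0" and "l \<ge> 0"
  shows "- (l * h) \<le> (l + \<alpha> * \<bar>h\<bar>) * \<bar>(1 / \<alpha>) * (l - max (l + \<alpha> * h) 0)\<bar>"
proof (cases "l + \<alpha> * h \<ge> 0")
  case True
  then have "\<bar>(1 / \<alpha>) * (l - max (l + \<alpha> * h) 0)\<bar> = \<bar>h\<bar>"
    using assms by (simp add: max_def abs_mult)
  moreover have "- (l * h) \<le> l * \<bar>h\<bar>"
    using assms by (simp add: abs_if)
  moreover have "0 \<le> \<alpha> * \<bar>h\<bar> * \<bar>h\<bar>"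
    using assms by simp
  ultimately show ?thesis
    by (simp add: distrib_right)
next
  case False
  then have active: "\<bar>(1 / \<alpha>) * (l - max (l + \<alpha> * h) 0)\<bar> = l / \<alpha>"
    using assms by (simp add: max_def)
  have "- (l * h) \<le> l * \<bar>h\<bar>"
    using assms by (simp add: abs_if)
  moreover have "(l + \<alpha> * \<bar>h\<bar>) * (l / \<alpha>) = l * l / \<alpha> + l * \<bar>h\<bar>"
    using assms by (simp add: field_simps)
  moreover have "0 \<le> l * l / \<alpha>"
    using assms by simp
  ultimately show ?thesis
    unfolding active by linarith
qed

lemma sum_approximate_complementary_slackness:
  fixes l h g :: "'i \<Rightarrow> real" and \<alpha> :: real
  assumes "\<alpha> > 0" and "\<And>j. j \<in> A \<Longrightarrow> l j \<ge> 0"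
    and "\<And>j. j \<in> A \<Longrightarrow> g j = (1 / \<alpha>) * (l j - max (l j + \<alpha> * h j) 0)"
  shows "- (\<Sum>j\<in>A. l j * h j) \<le> (L2_set l A + \<alpha> * L2_set h A) * L2_set g A"
proof -
  have "- (\<Sum>j\<in>A. l j * h j) \<le> (\<Sum>j\<in>A. (l j + \<alpha> * \<bar>h j\<bar>) * \<bar>g j\<bar>)"
    unfolding sum_negf[symmetric]
    using assms by (intro sum_mono) (simp only: approximate_complementary_slackness)
  also have "\<dots> = (\<Sum>j\<in>A. l j * \<bar>g j\<bar>) + \<alpha> * (\<Sum>j\<in>A. \<bar>h j\<bar> * \<bar>g j\<bar>)"
    by (simp add: distrib_right sum.distrib sum_distrib_left mult.assoc)
  also have "\<dots> \<le> L2_set l A * L2_set g A + \<alpha> * (L2_set h A * L2_set g A)"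
    using assms(1) mult_sum_le_L2_set[of l "\<lambda>j. \<bar>g j\<bar>" A] L2_set_mult_ineq[of h g A]
    by (intro add_mono mult_left_mono) (auto simp: L2_set_abs)
  finally show ?thesis
    by (simp add: distrib_right mult.assoc)
qed

section \<open>Guarantees for the softmax classifier\<close>

theorem lemma3p5:
  fixes P :: "'x measure" and M :: nat
    and L Lh :: "'x \<Rightarrow> real ^ 'a"
    and C Ch :: "'x \<Rightarrow> nat \<Rightarrow> real ^ 'a"
    and \<alpha> \<beta> :: real and lam :: "nat \<Rightarrow> real"
  assumes "prob_space P"
    and "L \<in> borel_measurable P" and "Lh \<in> borel_measurable P"
    and "\<And>j. j \<in> {1..M} \<Longrightarrow> (\<lambda>x. C x j) \<in> borel_measurable P"
    and "\<And>j. j \<in> {1..M} \<Longrightarrow> (\<lambda>x. Ch x j) \<in> borel_measurable P"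
    and "integrable P (\<lambda>x. norm (L x))" and "integrable P (\<lambda>x. norm (Lh x))"
    and "integrable P (\<lambda>x. opnorm_2_2 M (C x))" and "integrable P (\<lambda>x. opnorm_2_2 M (Ch x))"
    and "integrable P (\<lambda>x. (opnorm_1_2 M (\<lambda>j. C x j - Ch x j))\<^sup>2)"
    and "\<exists>\<pi>. randomized_prediction P \<pi> \<and> (\<forall>j\<in>{1..M}. cost P C j \<pi> < 0)"
    and "\<exists>\<pi>. randomized_prediction P \<pi> \<and> (\<forall>j\<in>{1..M}. cost P Ch j \<pi> < 0)"
    and "\<alpha> > 0" and "\<beta> > 0" and "\<forall>j\<in>{1..M}. lam j \<ge> 0"
  shows "sqrt (\<Sum>j\<in>{1..M}. (max (cost P C j (softmax_classifier M \<beta> Lh Ch lam)) 0)\<^sup>2)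
      \<le> L2_set (grad_mapping P M \<alpha> \<beta> Lh Ch lam) {1..M} + \<Delta>_constr P M C Ch
    \<and> (\<forall>\<pi>. randomized_prediction P \<pi> \<and> (\<forall>j\<in>{1..M}. cost P C j \<pi> \<le> 0) \<longrightarrow>
      risk P L (softmax_classifier M \<beta> Lh Ch lam)
        \<le> risk P L \<pi>
          + (L2_set lam {1..M} + \<alpha> * (\<integral>x. opnorm_1_2 M (Ch x) \<partial>P))
              * L2_set (grad_mapping P M \<alpha> \<beta> Lh Ch lam) {1..M}
          + 2 * \<Delta>_loss P L Lh
          + \<Delta>_constr P M C Ch * L2_set lam {1..M}
          + 2 * ln (real CARD('a)) / \<beta>)"
proof (intro conjI allI impI)
  let ?s = "softmax_classifier M \<beta> Lh Ch lam"
  let ?I = "{1..M}"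
  define h where "h = (\<lambda>j. cost P Ch j ?s)"
  define g where "g = grad_mapping P M \<alpha> \<beta> Lh Ch lam"
  define \<delta> where "\<delta> = \<Delta>_constr P M C Ch"
  have s: "randomized_prediction P ?s"
    using assms(3,5) by (rule randomized_prediction_softmax_classifier)
  have Lh: "\<And>a. integrable P (\<lambda>x. Lh x $ a)"
    by (rule integrable_vec_nth[OF assms(3,7)])
  have C: "\<And>j a. j \<in> ?I \<Longrightarrow> integrable P (\<lambda>x. C x j $ a)"
    by (rule integrable_matrix_entry[OF assms(4,8)])
  have Ch: "\<And>j a. j \<in> ?I \<Longrightarrow> integrable P (\<lambda>x. Ch x j $ a)"
    by (rule integrable_matrix_entry[OF assms(5,9)])
  have opnorm_diff: "(\<lambda>x. opnorm_1_2 M (\<lambda>j. C x j - Ch x j)) \<in> borel_measurable P"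
    using assms(4,5) by (intro borel_measurable_opnorm_1_2 borel_measurable_diff)
  have cost_error: "L2_set (\<lambda>j. cost P C j \<rho> - cost P Ch j \<rho>) ?I \<le> \<delta>"
    if "randomized_prediction P \<rho>" for \<rho>
    unfolding \<delta>_def by (rule L2_set_cost_diff_le[OF assms(1) that C Ch opnorm_diff assms(10)])
  have g: "g j = (1 / \<alpha>) * (lam j - max (lam j + \<alpha> * h j) 0)" if "j \<in> ?I" for j
    using grad_dual_objective[OF assms(1,14) that Lh Ch s]
    by (simp add: g_def grad_mapping_def h_def)

  have "sqrt (\<Sum>j\<in>?I. (max (cost P C j ?s) 0)\<^sup>2) = L2_set (\<lambda>j. max (cost P C j ?s) 0) ?I"
    by (simp add: L2_set_def)
  also have "\<dots> \<le> L2_set (\<lambda>j. \<bar>g j\<bar> + \<bar>cost P C j ?s - h j\<bar>) ?I"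
  proof (rule L2_set_mono)
    fix j assume j: "j \<in> ?I"
    then have "max (h j) 0 \<le> \<bar>g j\<bar>"
      using pos_part_le_gradient_mapping[of \<alpha> "lam j" "h j"] assms(13,15) g[OF j] by simp
    then show "max (cost P C j ?s) 0 \<le> \<bar>g j\<bar> + \<bar>cost P C j ?s - h j\<bar>"
      by linarith
  qed simp
  also have "\<dots> \<le> L2_set g ?I + L2_set (\<lambda>j. cost P C j ?s - h j) ?I"
    using L2_set_triangle_ineq[of "\<lambda>j. \<bar>g j\<bar>" "\<lambda>j. \<bar>cost P C j ?s - h j\<bar>" ?I]
    by (simp add: L2_set_abs)
  also have "\<dots> \<le> L2_set g ?I + \<delta>"
    using cost_error[OF s] by (simp add: h_def)
  finally show "sqrt (\<Sum>j\<in>?I. (max (cost P C j ?s) 0)\<^sup>2)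
      \<le> L2_set (grad_mapping P M \<alpha> \<beta> Lh Ch lam) ?I + \<Delta>_constr P M C Ch"
    by (simp add: g_def \<delta>_def)

  fix \<pi>
  assume "randomized_prediction P \<pi> \<and> (\<forall>j\<in>?I. cost P C j \<pi> \<le> 0)"
  then have \<pi>: "randomized_prediction P \<pi>" and feasible: "\<And>j. j \<in> ?I \<Longrightarrow> cost P C j \<pi> \<le> 0"
    by auto
  have loss_error: "\<bar>risk P L \<rho> - risk P Lh \<rho>\<bar> \<le> \<Delta>_loss P L Lh"
    if "randomized_prediction P \<rho>" for \<rho>
    by (rule risk_diff_le[OF that assms(2,3,6,7)])
  have competitor: "(\<Sum>j\<in>?I. lam j * cost P Ch j \<pi>) \<le> \<delta> * L2_set lam ?I"
  proof -
    have "(\<Sum>j\<in>?I. lam j * cost P Ch j \<pi>) \<le>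
        (\<Sum>j\<in>?I. lam j * \<bar>cost P C j \<pi> - cost P Ch j \<pi>\<bar>)"
    proof (intro sum_mono mult_left_mono)
      fix j assume j: "j \<in> ?I"
      show "cost P Ch j \<pi> \<le> \<bar>cost P C j \<pi> - cost P Ch j \<pi>\<bar>"
        using feasible[OF j] by linarith
      show "0 \<le> lam j"
        using assms(15) j by blast
    qed
    also have "\<dots> \<le> L2_set lam ?I * L2_set (\<lambda>j. cost P C j \<pi> - cost P Ch j \<pi>) ?I"
      using mult_sum_le_L2_set[of lam "\<lambda>j. \<bar>cost P C j \<pi> - cost P Ch j \<pi>\<bar>" ?I]
      by (simp add: L2_set_abs)
    also have "\<dots> \<le> L2_set lam ?I * \<delta>"
      by (intro mult_left_mono cost_error[OF \<pi>]) simp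
    finally show ?thesis
      by (simp add: mult.commute)
  qed
  have slackness: "- (\<Sum>j\<in>?I. lam j * h j) \<le>
      (L2_set lam ?I + \<alpha> * (\<integral>x. opnorm_1_2 M (Ch x) \<partial>P)) * L2_set g ?I"
  proof -
    have "L2_set h ?I \<le> (\<integral>x. opnorm_1_2 M (Ch x) \<partial>P)"
      unfolding h_def
      by (rule L2_set_predicted_mean_le[OF s Ch integrable_opnorm_1_2[OF assms(5,9)]])
    then have "(L2_set lam ?I + \<alpha> * L2_set h ?I) * L2_set g ?I \<le>
        (L2_set lam ?I + \<alpha> * (\<integral>x. opnorm_1_2 M (Ch x) \<partial>P)) * L2_set g ?I"
      using assms(13) by (intro mult_right_mono add_left_mono mult_left_mono) auto
    moreover have "- (\<Sum>j\<in>?I. lam j * h j) \<le> (L2_set lam ?I + \<alpha> * L2_set h ?I) * L2_set g ?I"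
      using assms(13,15) g by (intro sum_approximate_complementary_slackness) auto
    ultimately show ?thesis
      by linarith
  qed
  have "risk P Lh ?s + (\<Sum>j\<in>?I. lam j * h j) \<le>
      risk P Lh \<pi> + (\<Sum>j\<in>?I. lam j * cost P Ch j \<pi>) + ln (real CARD('a)) / \<beta>"
    unfolding h_def by (rule softmax_lagrangian_le[OF assms(1,14) Lh Ch s \<pi>])
  moreover have "0 \<le> ln (real CARD('a)) / \<beta>"
    using assms(14) by (simp add: Suc_leI)
  ultimately show "risk P L ?s
        \<le> risk P L \<pi>
          + (L2_set lam ?I + \<alpha> * (\<integral>x. opnorm_1_2 M (Ch x) \<partial>P))
              * L2_set (grad_mapping P M \<alpha> \<beta> Lh Ch lam) ?I
          + 2 * \<Delta>_loss P L Lh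
          + \<Delta>_constr P M C Ch * L2_set lam ?I
          + 2 * ln (real CARD('a)) / \<beta>"
    using competitor slackness loss_error[OF s] loss_error[OF \<pi>]
    unfolding g_def[symmetric] \<delta>_def[symmetric] by linarith
qed

end
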